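(* Let $m\ge 0$ and $n\ge 1$ be integers, and let $R$ be a field of characteristic either zero or a prime $p>2\lfloor m/2\rfloor$. Let $E^m$ be the Grassmann algebra of rank $m$ over $R$. Then the standard identity of degree $k=2(n+\lfloor m/2\rfloor)-1$ does not hold in the ring $M_nE^m$ of $n\times n$ matrices over $E^m$.
   Context: The Grassmann algebra of rank $m$ over $R$ is the $R$-algebra $E^m=R\langle v_1,\dots,v_m\rangle/(v_k^2,\ v_iv_j+v_jv_i\mid 1\le k\le m,\ 1\le i<j\le m)$. The standard polynomial $s_k$ is the polynomial in noncommuting variables $$s_k(x_1,\dots,x_k)=\sum_{\pi\in\mathfrak S_k}(-1)^\pi\, x_{\pi(1)}x_{\pi(2)}\cdots x_{\pi(k)},$$ where $\mathfrak S_k$ is the symmetric group on $\{1,\dots,k\}$ and $(-1)^\pi$ is the sign of $\pi$. The standard identity of degree $k$ holds in a ring $\mathfrak A$ if $s_k(x_1,\dots,x_k)=0$ for all $x_1,\dots,x_k\in\mathfrak A$. *)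

theory Defs
  imports
    "HOL-Library.Poly_Mapping"
    "HOL-Combinatorics.Permutations"
    "HOL-Computational_Algebra.Primes"
    "HOL-Algebra.QuotRing"
    "Jordan_Normal_Form.Matrix"
begin

datatype nc_word = Word (letters: "nat list")

text \<open>
  The free monoid on letters \<open>v\<^sub>i\<close>, written additively because the convolution product on
  the type of finitely supported functions uses addition in their domain.
  Thus \<^typ>\<open>nc_word \<Rightarrow>\<^sub>0 'a\<close> is the free associative algebra on these letters.
\<close>

instantiation nc_word :: monoid_add
begin

definition zero_nc_word :: nc_word where
  "0 = Word []"

definition plus_nc_word :: "nc_word \<Rightarrow> nc_word \<Rightarrow> nc_word" where
  "u + w = Word (letters u @ letters w)"

instance
  by standard (simp_all add: zero_nc_word_def plus_nc_word_def)

end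

definition free_algebra :: "'a::comm_ring_1 itself \<Rightarrow> nat \<Rightarrow> (nc_word \<Rightarrow>\<^sub>0 'a) ring" where
  "free_algebra ty m =
    \<lparr>carrier = {f. \<forall>w\<in>Poly_Mapping.keys f. set (letters w) \<subseteq> {1..m}},
     mult = (*), one = 1, zero = 0, add = (+)\<rparr>"

definition var :: "nat \<Rightarrow> (nc_word \<Rightarrow>\<^sub>0 'a::comm_ring_1)" where
  "var i = Poly_Mapping.single (Word [i]) 1"

definition grassmann_relations :: "nat \<Rightarrow> (nc_word \<Rightarrow>\<^sub>0 'a::comm_ring_1) set" where
  "grassmann_relations m =
     {var k * var k | k. 1 \<le> k \<and> k \<le> m} \<union>
     {var i * var j + var j * var i | i j. 1 \<le> i \<and> i < j \<and> j \<le> m}"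

text \<open>
  Ideals of \<^theory>\<open>HOL-Algebra.Ideal\<close> are two-sided. The lemma \<open>ring_free_algebra\<close> below
  guarantees that the generated ideal is a genuine one.
\<close>

definition grassmann_algebra ::
    "'a::comm_ring_1 itself \<Rightarrow> nat \<Rightarrow> (nc_word \<Rightarrow>\<^sub>0 'a) set ring" where
  "grassmann_algebra ty m =
     free_algebra ty m Quot genideal (free_algebra ty m) (grassmann_relations m)"

text \<open>
  Matrices over a ring given by a record; the library's \<^const>\<open>ring_mat\<close> requires the
  entries to form a type of class \<^class>\<open>semiring_1\<close>.
\<close>

definition matrix_ring :: "nat \<Rightarrow> ('r, 'b) ring_scheme \<Rightarrow> 'r mat ring" where
  "matrix_ring n A =
    \<lparr>carrier = {M \<in> carrier_mat n n. elements_mat M \<subseteq> carrier A},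
     mult = (\<lambda>M N. mat n n (\<lambda>(i, j).
               \<Oplus>\<^bsub>A\<^esub>l\<in>{..<n}. M $$ (i, l) \<otimes>\<^bsub>A\<^esub> N $$ (l, j))),
     one = mat n n (\<lambda>(i, j). if i = j then \<one>\<^bsub>A\<^esub> else \<zero>\<^bsub>A\<^esub>),
     zero = mat n n (\<lambda>(i, j). \<zero>\<^bsub>A\<^esub>),
     add = (\<lambda>M N. mat n n (\<lambda>(i, j). M $$ (i, j) \<oplus>\<^bsub>A\<^esub> N $$ (i, j)))\<rparr>"

definition standard_polynomial ::
    "('r, 'b) ring_scheme \<Rightarrow> nat \<Rightarrow> (nat \<Rightarrow> 'r) \<Rightarrow> 'r" where
  "standard_polynomial A k x =
     (\<Oplus>\<^bsub>A\<^esub>\<pi>\<in>{\<pi>. \<pi> permutes {1..k}}.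
        [sign \<pi>] \<cdot>\<^bsub>A\<^esub> foldr (\<lambda>i y. x (\<pi> i) \<otimes>\<^bsub>A\<^esub> y) [1..<Suc k] \<one>\<^bsub>A\<^esub>)"

definition standard_identity :: "('r, 'b) ring_scheme \<Rightarrow> nat \<Rightarrow> bool" where
  "standard_identity A k \<longleftrightarrow>
     (\<forall>x\<in>{1..k} \<rightarrow> carrier A. standard_polynomial A k x = \<zero>\<^bsub>A\<^esub>)"

lemma ring_free_algebra: "ring (free_algebra TYPE('a::comm_ring_1) m)"
proof (rule ringI)
  show "abelian_group (free_algebra TYPE('a) m)"
  proof (rule abelian_groupI, goal_cases)
    case (1 x y)
    then show ?case
      using Poly_Mapping.keys_add[of x y] by (auto simp: free_algebra_def)
  next
    case (6 x)
    then show ?case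
      by (intro bexI[of _ "- x"]) (auto simp: free_algebra_def)
  qed (auto simp: free_algebra_def add_ac)
  show "monoid (free_algebra TYPE('a) m)"
  proof (rule monoidI, goal_cases)
    case (1 x y)
    then show ?case
      using keys_mult[of x y]
      by (fastforce simp: free_algebra_def plus_nc_word_def)
  next
    case 2
    then show ?case
      by (auto simp: free_algebra_def zero_nc_word_def simp flip: single_one)
  qed (auto simp: free_algebra_def mult.assoc)
qed (auto simp: free_algebra_def algebra_simps)

lemma grassmann_relations_subset:
  "grassmann_relations m \<subseteq> carrier (free_algebra TYPE('a::comm_ring_1) m)"
  using Poly_Mapping.keys_add
  by (fastforce simp: grassmann_relations_def free_algebra_def var_def mult_single plus_nc_word_def
      split: if_splits)

lemma ring_grassmann_algebra: "ring (grassmann_algebra TYPE('a::comm_ring_1) m)"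
  unfolding grassmann_algebra_def
  by (intro ideal.quotient_is_ring ring.genideal_ideal ring_free_algebra
      grassmann_relations_subset)

end

theory Submission
  imports Defs
begin

text \<open>
  Put \<open>N = 2\<lfloor>m/2\<rfloor>\<close> and substitute \<open>v\<^sub>1 e\<^sub>1\<^sub>1, \<dots>, v\<^sub>N e\<^sub>1\<^sub>1\<close> followed by the staircase
  \<open>e\<^sub>1\<^sub>1, e\<^sub>1\<^sub>2, e\<^sub>2\<^sub>2, e\<^sub>2\<^sub>3, \<dots>, e\<^sub>n\<^sub>n\<close>. A product of these matrices in some order is nonzero
  only if the matrix units form a path; since a staircase path never returns to an earlier vertex,
  this forces every factor after the first \<open>e\<^sub>1\<^sub>1\<close> to stay in place. So the \<open>(1, n)\<close> entry of the
  standard polynomial is \<open>s\<^sub>N\<^sub>+\<^sub>1(v\<^sub>1, \<dots>, v\<^sub>N, 1) = s\<^sub>N(v\<^sub>1, \<dots>, v\<^sub>N) = N! v\<^sub>1 \<cdots> v\<^sub>N\<close>, where the first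
  equality holds because the \<open>N + 1\<close> positions of the unit contribute alternating signs and \<open>N\<close> is
  even. It is nonzero because the signed sum of the coefficients of the words
  \<open>v\<^bsub>\<pi>(1)\<^esub> \<cdots> v\<^bsub>\<pi>(N)\<^esub>\<close> is a linear functional on the free algebra that kills the Grassmann ideal,
  and \<open>N!\<close> is nonzero in the field.
\<close>

section \<open>The signed coefficient functional on the free algebra\<close>

definition perm_word :: "nat \<Rightarrow> (nat \<Rightarrow> nat) \<Rightarrow> nc_word" where
  "perm_word N \<pi> = Word (map \<pi> [1..<Suc N])"

text \<open>Modulo the Grassmann relations this is the coefficient of v_1...v_N: sorting a word that
  permutes 1..N costs the sign of the permutation.\<close>

definition top_form :: "nat \<Rightarrow> (nc_word \<Rightarrow>\<^sub>0 'a::comm_ring_1) \<Rightarrow> 'a" where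
  "top_form N f =
     (\<Sum>\<pi> | \<pi> permutes {1..N}. of_int (sign \<pi>) * Poly_Mapping.lookup f (perm_word N \<pi>))"

lemma top_form_0 [simp]: "top_form N 0 = 0"
  by (simp add: top_form_def)

lemma top_form_add: "top_form N (f + g) = top_form N f + top_form N g"
  by (simp add: top_form_def lookup_add distrib_left sum.distrib)

lemma perm_word_inj:
  assumes "\<pi> permutes {1..N}" "\<rho> permutes {1..N}" "perm_word N \<pi> = perm_word N \<rho>"
  shows "\<pi> = \<rho>"
proof
  fix i
  show "\<pi> i = \<rho> i"
  proof (cases "i \<in> {1..N}")
    case True
    then show ?thesis
      using assms(3) by (auto simp: perm_word_def simp del: upt_Suc)
  next
    case False
    then show ?thesis
      using assms(1,2) by (simp add: permutes_not_in)
  qed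
qed

lemma top_form_perm_word:
  assumes "\<pi> permutes {1..N}"
  shows "top_form N (Poly_Mapping.single (perm_word N \<pi>) (1::'a::comm_ring_1)) = of_int (sign \<pi>)"
proof -
  have "top_form N (Poly_Mapping.single (perm_word N \<pi>) (1::'a)) =
      (\<Sum>\<rho> | \<rho> permutes {1..N}. if \<rho> = \<pi> then of_int (sign \<rho>) else 0)"
    unfolding top_form_def
    using perm_word_inj[OF assms] by (intro sum.cong) (auto simp: lookup_single when_def)
  also have "\<dots> = of_int (sign \<pi>)"
    using assms by (simp add: finite_permutations)
  finally show ?thesis .
qed

lemma sign_comp_transpose:
  assumes "\<pi> permutes {1..N::nat}" "i \<noteq> j"
  shows "sign (\<pi> \<circ> transpose i j) = - sign \<pi>"
  using assms permutes_imp_permutation[OF finite_atLeastAtMost assms(1)]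
  by (simp add: sign_compose permutation_swap_id sign_swap_id)

text \<open>Precomposing with a transposition acts on positions. These count from 1, so the two
  entries after the prefix \<open>a\<close> sit at \<open>Suc (length a)\<close> and its
  successor.\<close>

lemma map_eq_append_transpose:
  fixes \<pi> :: "nat \<Rightarrow> 'b"
  assumes "map \<pi> [1..<Suc N] = a @ x # y # b"
  shows "map (\<pi> \<circ> transpose (Suc (length a)) (Suc (Suc (length a)))) [1..<Suc N] =
    a @ y # x # b"
proof (rule nth_equalityI)
  have N: "N = length a + length b + 2"
    using arg_cong[OF assms, of length] by (simp del: upt_Suc)
  then show "length (map (\<pi> \<circ> transpose (Suc (length a)) (Suc (Suc (length a)))) [1..<Suc N]) =
      length (a @ y # x # b)"
    by (simp del: upt_Suc)
  have nth: "\<pi> (Suc i) = (a @ x # y # b) ! i" if "i < N" for i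
    using arg_cong[OF assms, of "\<lambda>l. l ! i"] that by (simp del: upt_Suc)
  fix i assume "i < length (map (\<pi> \<circ> transpose (Suc (length a)) (Suc (Suc (length a)))) [1..<Suc N])"
  then have i: "i < N" by (simp del: upt_Suc)
  consider "i = length a" | "i = Suc (length a)" | "i \<noteq> length a" "i \<noteq> Suc (length a)" by blast
  then show "map (\<pi> \<circ> transpose (Suc (length a)) (Suc (Suc (length a)))) [1..<Suc N] ! i =
      (a @ y # x # b) ! i"
  proof cases
    case 1
    then show ?thesis using nth[of "Suc i"] N i by (simp del: upt_Suc add: nth_append)
  next
    case 2
    then show ?thesis using nth[of "i - 1"] N i by (simp del: upt_Suc add: nth_append)
  next
    case 3
    then have "transpose (Suc (length a)) (Suc (Suc (length a))) (Suc i) = Suc i"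
      by (simp add: transpose_apply_other)
    then show ?thesis using 3 nth[of i] i
      by (auto simp del: upt_Suc simp: nth_append nth_Cons split: nat.splits)
  qed
qed

text \<open>Precomposition with the transposition of the two positions pairs the permutations
  spelling one word with those spelling the other and reverses the sign. A word of the wrong length
  is spelled by none.\<close>

lemma top_form_anticomm:
  "top_form N (Poly_Mapping.single (Word (a @ i # j # b)) c + 
     Poly_Mapping.single (Word (a @ j # i # b)) (c::'a::comm_ring_1)) = 0"
proof (cases "length a + length b + 2 = N")
  case False
  then have "Word (a @ x # y # b) \<noteq> perm_word N \<pi>" for \<pi> x y
    by (auto simp: perm_word_def dest: arg_cong[of _ _ length])
  then show ?thesis
    by (auto simp: top_form_def lookup_add lookup_single when_def)
next
  case True
  define \<tau> where "\<tau> = transpose (Suc (length a)) (Suc (Suc (length a)))"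
  have \<tau>: "\<tau> permutes {1..N}"
    unfolding \<tau>_def using True by (intro permutes_swap_id) auto
  have \<tau>\<tau>: "\<pi> \<circ> \<tau> \<circ> \<tau> = \<pi>" for \<pi> :: "nat \<Rightarrow> nat"
    by (simp add: \<tau>_def comp_assoc)
  have iff: "Word (a @ j # i # b) = perm_word N (\<pi> \<circ> \<tau>) \<longleftrightarrow> Word (a @ i # j # b) = perm_word N \<pi>" for \<pi>
    using map_eq_append_transpose[of \<pi> N a i j b] map_eq_append_transpose[of "\<pi> \<circ> \<tau>" N a j i b] \<tau>\<tau>
    unfolding \<tau>_def perm_word_def nc_word.inject by metis
  have "top_form N (Poly_Mapping.single (Word (a @ j # i # b)) c) =
      (\<Sum>\<pi> | \<pi> permutes {1..N}. of_int (sign (\<pi> \<circ> \<tau>)) *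
         Poly_Mapping.lookup (Poly_Mapping.single (Word (a @ j # i # b)) c) (perm_word N (\<pi> \<circ> \<tau>)))"
    unfolding top_form_def by (rule sum_permutations_compose_right[OF \<tau>])
  also have "\<dots> = (\<Sum>\<pi> | \<pi> permutes {1..N}. - (of_int (sign \<pi>) *
         Poly_Mapping.lookup (Poly_Mapping.single (Word (a @ i # j # b)) c) (perm_word N \<pi>)))"
  proof (rule sum.cong)
    fix \<pi> assume "\<pi> \<in> {\<pi>. \<pi> permutes {1..N}}"
    then have "sign (\<pi> \<circ> \<tau>) = - sign \<pi>"
      unfolding \<tau>_def by (intro sign_comp_transpose) auto
    moreover have "Poly_Mapping.lookup (Poly_Mapping.single (Word (a @ j # i # b)) c) (perm_word N (\<pi> \<circ> \<tau>)) =
      Poly_Mapping.lookup (Poly_Mapping.single (Word (a @ i # j # b)) c) (perm_word N \<pi>)"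
      using iff[of \<pi>] by (auto simp: lookup_single when_def)
    ultimately show "of_int (sign (\<pi> \<circ> \<tau>)) *
         Poly_Mapping.lookup (Poly_Mapping.single (Word (a @ j # i # b)) c) (perm_word N (\<pi> \<circ> \<tau>)) =
       - (of_int (sign \<pi>) * Poly_Mapping.lookup (Poly_Mapping.single (Word (a @ i # j # b)) c) (perm_word N \<pi>))"
      by simp
  qed simp
  also have "\<dots> = - top_form N (Poly_Mapping.single (Word (a @ i # j # b)) c)"
    by (simp add: top_form_def sum_negf)
  finally show ?thesis by (simp add: top_form_add)
qed

text \<open>A permutation never repeats a letter. Taking \<open>i = j\<close> in
  \<open>top_form_anticomm\<close> would give only twice this value, which says nothing in
  characteristic 2.\<close>

lemma top_form_square:
  "top_form N (Poly_Mapping.single (Word (a @ i # i # b)) (c::'a::comm_ring_1)) = 0"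
proof -
  have "Word (a @ i # i # b) \<noteq> perm_word N \<pi>" if "\<pi> permutes {1..N}" for \<pi>
  proof
    assume "Word (a @ i # i # b) = perm_word N \<pi>"
    then have "map \<pi> [1..<Suc N] = a @ i # i # b" by (simp add: perm_word_def)
    moreover have "distinct (map \<pi> [1..<Suc N])"
      using permutes_inj[OF that] by (simp add: distinct_map inj_on_def inj_def del: upt_Suc)
    ultimately show False by simp
  qed
  then show ?thesis
    unfolding top_form_def by (intro sum.neutral) (auto simp: lookup_single when_def)
qed

text \<open>Builds a polynomial one monomial at a time, so additive claims need checking only on
  single words.\<close>

lemma poly_mapping_sum_induct [case_names zero add]:
  assumes "P 0" "\<And>f a b. P f \<Longrightarrow> P (Poly_Mapping.single a (b::'b::comm_monoid_add) + f)"
  shows "P f"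
proof (induction f rule: update_induct)
  case const
  show ?case by fact
next
  case (update f a b)
  have "Poly_Mapping.update a b f = Poly_Mapping.single a b + f"
    using update(1)
    by (intro poly_mapping_eqI) (auto simp: lookup_update lookup_add lookup_single in_keys_iff)
  then show ?case using assms(2)[OF update(3)] by simp
qed

text \<open>Multiplying a relation by words on both sides only supplies the prefix and suffix in
  \<open>top_form_square\<close> and \<open>top_form_anticomm\<close>.\<close>

lemma top_form_relation_single:
  assumes "r \<in> grassmann_relations m"
  shows "top_form N (Poly_Mapping.single u b * r * Poly_Mapping.single w (c::'a::comm_ring_1)) = 0"
proof -
  from assms consider k where "r = var k * var k" | i j where "r = var i * var j + var j * var i"
    by (auto simp: grassmann_relations_def)
  then show ?thesis
  proof cases
    case 1
    then show ?thesis
      using top_form_square[of N "letters u" k "letters w" "b * c"]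
      by (simp add: var_def mult_single plus_nc_word_def)
  next
    case 2
    then show ?thesis
      using top_form_anticomm[of N "letters u" i j "letters w" "b * c"]
      by (simp add: var_def mult_single plus_nc_word_def distrib_left distrib_right)
  qed
qed

lemma top_form_relation:
  assumes "r \<in> grassmann_relations m"
  shows "top_form N (g * r * (h :: nc_word \<Rightarrow>\<^sub>0 'a::comm_ring_1)) = 0"
proof (induction g rule: poly_mapping_sum_induct)
  case (add g u b)
  have "top_form N (Poly_Mapping.single u b * r * h) = 0"
  proof (induction h rule: poly_mapping_sum_induct)
    case (add h w c)
    then show ?case
      by (simp add: distrib_left top_form_add top_form_relation_single[OF assms])
  qed simp
  with add show ?case by (simp add: distrib_right top_form_add)
qed simp

lemma top_form_genideal:
  assumes "f \<in> genideal (free_algebra TYPE('a::comm_ring_1) m) (grassmann_relations m)"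
  shows "top_form N f = 0"
proof -
  let ?F = "free_algebra TYPE('a) m"
  interpret F: ring ?F by (rule ring_free_algebra)
  have ops: "x \<oplus>\<^bsub>?F\<^esub> y = x + y" "x \<otimes>\<^bsub>?F\<^esub> y = x * y" "\<zero>\<^bsub>?F\<^esub> = 0" for x y
    by (simp_all add: free_algebra_def)
  \<comment> \<open>The kernel of \<open>top_form\<close> need not be an ideal; \<open>J\<close>
    collects the elements all of whose two-sided multiples lie in it. Letting \<open>g\<close> and
    \<open>h\<close> range over the whole type makes this condition stable under products by
    associativity.\<close>
  define J where "J = {f \<in> carrier ?F. \<forall>g h. top_form N (g * f * h) = 0}"
  have "ideal J ?F"
  proof (rule idealI[OF ring_free_algebra])
    show "subgroup J (add_monoid ?F)"
    proof (rule F.add.subgroupI)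
      show "J \<subseteq> carrier ?F" by (auto simp: J_def)
      have "0 \<in> J" using F.zero_closed by (simp add: J_def ops)
      then show "J \<noteq> {}" by auto
      fix a b assume "a \<in> J" "b \<in> J"
      then show "a \<oplus>\<^bsub>?F\<^esub> b \<in> J"
        using F.a_closed[of a b]
        by (simp add: J_def distrib_left distrib_right top_form_add ops)
    next
      fix a assume a: "a \<in> J"
      define b where "b = \<ominus>\<^bsub>?F\<^esub> a"
      have b: "b + a = 0" "b \<in> carrier ?F"
        using F.l_neg[of a] F.a_inv_closed[of a] a unfolding b_def ops J_def by blast+
      have "top_form N (g * b * h) + top_form N (g * a * h) = 0" for g h
        using b(1) by (simp flip: top_form_add distrib_left distrib_right)
      then have "b \<in> J" using a b(2) by (simp add: J_def)
      then show "\<ominus>\<^bsub>?F\<^esub> a \<in> J" by (simp only: b_def)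
    qed
  next
    fix a x assume *: "a \<in> J" "x \<in> carrier ?F"
    then have "x * a \<in> carrier ?F" "a * x \<in> carrier ?F"
      using F.m_closed[of x a] F.m_closed[of a x] unfolding J_def ops by blast+
    moreover have "top_form N (g * (x * a) * h) = 0" "top_form N (g * (a * x) * h) = 0" for g h
    proof -
      have "top_form N ((g * x) * a * h) = 0" "top_form N (g * a * (x * h)) = 0"
        using *(1) unfolding J_def by blast+
      then show "top_form N (g * (x * a) * h) = 0" "top_form N (g * (a * x) * h) = 0"
        by (simp_all only: mult.assoc)
    qed
    ultimately show "x \<otimes>\<^bsub>?F\<^esub> a \<in> J" "a \<otimes>\<^bsub>?F\<^esub> x \<in> J"
      unfolding J_def ops by blast+
  qed
  moreover have "grassmann_relations m \<subseteq> J"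
    using grassmann_relations_subset top_form_relation by (auto simp: J_def)
  ultimately have "f \<in> J" using F.genideal_minimal assms by blast
  then have "top_form N (1 * f * 1) = 0" unfolding J_def by blast
  then show ?thesis by simp
qed


section \<open>Paths of matrix units and the staircase\<close>

text \<open>Edge \<open>i\<close> stands for the matrix unit in row \<open>src i\<close> and column
  \<open>tgt i\<close>; a product of matrix units has entry 1 at \<open>(r, c)\<close> exactly when
  its factors form such a path.\<close>

fun is_path :: "('i \<Rightarrow> 'v) \<Rightarrow> ('i \<Rightarrow> 'v) \<Rightarrow> 'v \<Rightarrow> 'i list \<Rightarrow> 'v \<Rightarrow> bool" where
  "is_path src tgt r [] c \<longleftrightarrow> r = c"
| "is_path src tgt r (i # l) c \<longleftrightarrow> r = src i \<and> is_path src tgt (tgt i) l c"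

lemma is_path_append:
  "is_path src tgt r (k @ l) c \<longleftrightarrow> (\<exists>v. is_path src tgt r k v \<and> is_path src tgt v l c)"
  by (induction k arbitrary: r) auto

lemma is_path_src_ge:
  fixes src tgt :: "'i \<Rightarrow> 'v::order"
  assumes "is_path src tgt r l c" "\<And>i. src i \<le> tgt i" "j \<in> set l"
  shows "r \<le> src j"
  using assms(1,3)
proof (induction l arbitrary: r)
  case (Cons i l)
  then show ?case using assms(2)[of i] by (auto intro: order_trans)
qed simp

text \<open>Edges never descend, so whatever follows an edge starts at or above its end. This
  replaces the recursive path condition by a comparison of any two edges in list order.\<close>

lemma is_path_sorted:
  fixes src tgt :: "'i \<Rightarrow> 'v::order"
  assumes "is_path src tgt r l c" "\<And>i. src i \<le> tgt i"
  shows "sorted_wrt (\<lambda>i j. tgt i \<le> src j) l"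
  using assms(1)
proof (induction l arbitrary: r)
  case (Cons i l)
  then show ?case using is_path_src_ge[of src tgt "tgt i" l c] assms(2) by auto
qed simp

text \<open>
  The staircase as an edge list on the vertices \<open>0, 1, \<dots>\<close>: edges up to \<open>d\<close> are loops at \<open>0\<close>
  (the truncated subtraction makes this uniform), then steps and loops alternate.
\<close>

definition stair_src :: "nat \<Rightarrow> nat \<Rightarrow> nat" where
  "stair_src d i = (i - d) div 2"

definition stair_tgt :: "nat \<Rightarrow> nat \<Rightarrow> nat" where
  "stair_tgt d i = Suc (i - d) div 2"

text \<open>On a path an edge \<open>i > d\<close> comes after every edge of smaller index, hence at
  position at least \<open>i\<close>. Working down from \<open>k\<close>, no room is left and each
  such edge keeps its place.\<close>

lemma stair_path_permutes:
  assumes \<pi>: "\<pi> permutes {1..k}"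
    and path: "is_path (stair_src d) (stair_tgt d) r (map \<pi> [1..<Suc k]) c"
  shows "\<pi> permutes {1..d}"
proof -
  let ?\<sigma> = "inv_into UNIV \<pi>"
  have \<sigma>: "?\<sigma> permutes {1..k}" using permutes_inv[OF \<pi>] .
  have \<pi>\<sigma>: "\<pi> (?\<sigma> i) = i" for i using permutes_inverses(1)[OF \<pi>] .
  have sorted: "sorted_wrt (\<lambda>i j. stair_tgt d i \<le> stair_src d j) (map \<pi> [1..<Suc k])"
    by (rule is_path_sorted[OF path]) (auto simp: stair_src_def stair_tgt_def)
  have less: "?\<sigma> j < ?\<sigma> i" if "d < i" "j < i" "j \<in> {1..k}" "i \<in> {1..k}" for i j
  proof (rule ccontr)
    assume "\<not> ?\<sigma> j < ?\<sigma> i"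
    moreover have "?\<sigma> j \<noteq> ?\<sigma> i" using \<pi>\<sigma> that(2) by (metis less_irrefl)
    ultimately have lt: "?\<sigma> i < ?\<sigma> j" by simp
    have "?\<sigma> i \<in> {1..k}" "?\<sigma> j \<in> {1..k}" using that permutes_in_image[OF \<sigma>] by auto
    \<comment> \<open>\<open>?\<sigma> i\<close> is the position of edge \<open>i\<close>, counted
      from 1, while list indices start at 0.\<close>
    then have "stair_tgt d (\<pi> (?\<sigma> i)) \<le> stair_src d (\<pi> (?\<sigma> j))"
      using sorted_wrt_nth_less[OF sorted, of "?\<sigma> i - 1" "?\<sigma> j - 1"] lt
      by (auto simp del: upt_Suc)
    then have "Suc (i - d) div 2 \<le> (j - d) div 2"
      by (simp add: \<pi>\<sigma> stair_src_def stair_tgt_def)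
    \<comment> \<open>Since \<open>j < i\<close> and \<open>d < i\<close>, edge \<open>j\<close>
      starts strictly below the end of edge \<open>i\<close>.\<close>
    also have "\<dots> \<le> (i - d - 1) div 2" using that by (intro div_le_mono) auto
    finally show False using that by presburger
  qed
  have ge: "i \<le> ?\<sigma> i" if "d < i" "i \<in> {1..k}" for i
  proof -
    \<comment> \<open>The \<open>i - 1\<close> smaller edges occupy distinct positions before that
      of \<open>i\<close>.\<close>
    have "?\<sigma> ` {1..<i} \<subseteq> {1..<?\<sigma> i}"
      using less[OF that(1)] that permutes_in_image[OF \<sigma>] by fastforce
    then have "card (?\<sigma> ` {1..<i}) \<le> card {1..<?\<sigma> i}" by (intro card_mono) auto
    moreover have "card (?\<sigma> ` {1..<i}) = card {1..<i}"
      using permutes_inj[OF \<sigma>] by (intro card_image) (auto simp: inj_on_def inj_def)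
    moreover have "?\<sigma> i \<in> {1..k}" using that permutes_in_image[OF \<sigma>] by auto
    ultimately show ?thesis using that by auto
  qed
  have fixed: "?\<sigma> i = i" if "d < i" for i
    using that
  proof (induction "k - i" arbitrary: i rule: less_induct)
    case less
    show ?case
    proof (cases "i \<in> {1..k}")
      case True
      show ?thesis
      proof (rule ccontr)
        assume "?\<sigma> i \<noteq> i"
        \<comment> \<open>By induction, position \<open>?\<sigma> i\<close> is already held by the
          edge with that index; injectivity forbids a second one.\<close>
        then have gt: "i < ?\<sigma> i" using ge[OF less(2) True] by simp
        moreover have "?\<sigma> i \<in> {1..k}" using True permutes_in_image[OF \<sigma>] by auto
        ultimately have "?\<sigma> (?\<sigma> i) = ?\<sigma> i" using less by (intro less(1)) auto
        then show False using gt injD[OF permutes_inj[OF \<sigma>]] by force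
      qed
    qed (rule permutes_not_in[OF \<sigma>])
  qed
  show ?thesis
  proof (rule permutes_superset[OF \<pi>])
    fix i assume "i \<in> {1..k} - {1..d}"
    then show "\<pi> i = i" using fixed[of i] \<pi>\<sigma>[of i] by auto
  qed
qed

lemma stair_path_initial:
  assumes "set l \<subseteq> {..d}"
  shows "is_path (stair_src d) (stair_tgt d) 0 l 0"
  using assms by (induction l) (auto simp: stair_src_def stair_tgt_def)

lemma stair_path_final:
  "is_path (stair_src d) (stair_tgt d) 0 [Suc d..<Suc (d + t)] (Suc t div 2)"
  by (induction t) (auto simp: is_path_append stair_src_def stair_tgt_def)

text \<open>The \<open>d\<close> initial loops may be shuffled freely; the remaining
  \<open>t\<close> edges must run in order and end at \<open>Suc t div 2\<close>.\<close>

lemma stair_path_iff: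
  assumes "\<pi> permutes {1..d + t}"
  shows "is_path (stair_src d) (stair_tgt d) 0 (map \<pi> [1..<Suc (d + t)]) (Suc t div 2)
    \<longleftrightarrow> \<pi> permutes {1..d}"
proof
  assume "\<pi> permutes {1..d}"
  have "[1..<Suc (d + t)] = [1..<Suc d] @ [Suc d..<Suc (d + t)]"
    using upt_add_eq_append[of 1 "Suc d" t] by simp
  moreover have "map \<pi> [Suc d..<Suc (d + t)] = [Suc d..<Suc (d + t)]"
    using \<open>\<pi> permutes {1..d}\<close> by (intro map_idI) (auto simp: permutes_not_in)
  moreover have "set (map \<pi> [1..<Suc d]) \<subseteq> {..d}"
    using permutes_in_image[OF \<open>\<pi> permutes {1..d}\<close>] by fastforce
  ultimately show "is_path (stair_src d) (stair_tgt d) 0 (map \<pi> [1..<Suc (d + t)]) (Suc t div 2)"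
    using stair_path_initial[of "map \<pi> [1..<Suc d]" d] stair_path_final[of d t]
    by (simp add: is_path_append del: upt_Suc) blast
qed (rule stair_path_permutes[OF assms])

section \<open>Matrices over a ring record and products of one-entry matrices\<close>

lemma matrix_ring_carrier_iff:
  "M \<in> carrier (matrix_ring n A) \<longleftrightarrow>
    M \<in> carrier_mat n n \<and> (\<forall>i<n. \<forall>j<n. M $$ (i, j) \<in> carrier A)"
  by (fastforce simp: matrix_ring_def)

lemma mat_in_matrix_ring:
  "mat n n f \<in> carrier (matrix_ring n A) \<longleftrightarrow> (\<forall>i<n. \<forall>j<n. f (i, j) \<in> carrier A)"
  by (simp add: matrix_ring_carrier_iff)

lemma matrix_ring_ops:
  "M \<oplus>\<^bsub>matrix_ring n A\<^esub> N = mat n n (\<lambda>(i, j). M $$ (i, j) \<oplus>\<^bsub>A\<^esub> N $$ (i, j))"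
  "\<zero>\<^bsub>matrix_ring n A\<^esub> = mat n n (\<lambda>(i, j). \<zero>\<^bsub>A\<^esub>)"
  "\<one>\<^bsub>matrix_ring n A\<^esub> = mat n n (\<lambda>(i, j). if i = j then \<one>\<^bsub>A\<^esub> else \<zero>\<^bsub>A\<^esub>)"
  "M \<otimes>\<^bsub>matrix_ring n A\<^esub> N = mat n n (\<lambda>(i, j). \<Oplus>\<^bsub>A\<^esub>l\<in>{..<n}. M $$ (i, l) \<otimes>\<^bsub>A\<^esub> N $$ (l, j))"
  by (simp_all add: matrix_ring_def)

lemma abelian_group_matrix_ring:
  assumes "ring A"
  shows "abelian_group (matrix_ring n A)"
proof -
  interpret A: ring A by fact
  show ?thesis
  proof (rule abelian_groupI, goal_cases)
    case (6 M)
    then show ?case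
      by (intro bexI[of _ "mat n n (\<lambda>(i, j). \<ominus>\<^bsub>A\<^esub> M $$ (i, j))"])
        (auto simp: matrix_ring_ops mat_in_matrix_ring matrix_ring_carrier_iff A.l_neg)
  qed (auto simp: matrix_ring_ops matrix_ring_carrier_iff A.a_ac intro!: eq_matI)
qed

text \<open>Multiplying by the one-entry matrix of \<open>i\<close> moves row \<open>tgt i\<close>
  of the remaining product to row \<open>src i\<close>, just as \<open>is_path\<close> consumes its
  first edge. The bound on \<open>tgt\<close> keeps that row inside the matrix.\<close>

lemma matrix_ring_foldr_monomial:
  assumes "ring A" and g: "\<And>i. i \<in> set l \<Longrightarrow> g i \<in> carrier A"
    and V: "\<And>i. i \<in> set l \<Longrightarrow> tgt i < n"
  shows "foldr (\<lambda>i M. mat n n (\<lambda>(r, c). if r = src i \<and> c = tgt i then g i else \<zero>\<^bsub>A\<^esub>)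
             \<otimes>\<^bsub>matrix_ring n A\<^esub> M) l \<one>\<^bsub>matrix_ring n A\<^esub> =
    mat n n (\<lambda>(r, c). if is_path src tgt r l c
                       then foldr (\<lambda>i y. g i \<otimes>\<^bsub>A\<^esub> y) l \<one>\<^bsub>A\<^esub> else \<zero>\<^bsub>A\<^esub>)"
  using g V
proof (induction l)
  case Nil
  then show ?case by (auto simp: matrix_ring_ops)
next
  case (Cons i l)
  interpret A: ring A by fact
  let ?p = "foldr (\<lambda>i y. g i \<otimes>\<^bsub>A\<^esub> y) l \<one>\<^bsub>A\<^esub>"
  have p: "?p \<in> carrier A"
    using Cons.prems(1) by (induction l) auto
  let ?X = "mat n n (\<lambda>(r, c). if r = src i \<and> c = tgt i then g i else \<zero>\<^bsub>A\<^esub>)"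
  let ?P = "mat n n (\<lambda>(r, c). if is_path src tgt r l c then ?p else \<zero>\<^bsub>A\<^esub>)"
  have entry: "(\<Oplus>\<^bsub>A\<^esub>v\<in>{..<n}. ?X $$ (r, v) \<otimes>\<^bsub>A\<^esub> ?P $$ (v, c)) =
    (if is_path src tgt r (i # l) c then g i \<otimes>\<^bsub>A\<^esub> ?p else \<zero>\<^bsub>A\<^esub>)" (is "?s = ?t")
    if "r < n" "c < n" for r c
  proof -
    \<comment> \<open>Only the summand \<open>v = tgt i\<close> can survive; if \<open>r\<close>
      differs from \<open>src i\<close>, it vanishes together with \<open>?t\<close>.\<close>
    have "?s = (\<Oplus>\<^bsub>A\<^esub>v\<in>{..<n}. if tgt i = v then ?t else \<zero>\<^bsub>A\<^esub>)"
      using p Cons.prems that by (intro A.finsum_cong') auto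
    also have "\<dots> = ?t"
      using p Cons.prems by (intro A.finsum_singleton[where f = "\<lambda>_. ?t"]) auto
    finally show ?thesis .
  qed
  have "?X \<otimes>\<^bsub>matrix_ring n A\<^esub> ?P = mat n n (\<lambda>(r, c).
      if is_path src tgt r (i # l) c then g i \<otimes>\<^bsub>A\<^esub> ?p else \<zero>\<^bsub>A\<^esub>)"
    unfolding matrix_ring_ops by (rule eq_matI) (simp_all only: entry index_mat dim_row_mat dim_col_mat split)
  moreover have "foldr (\<lambda>i M. mat n n (\<lambda>(r, c). if r = src i \<and> c = tgt i then g i else \<zero>\<^bsub>A\<^esub>)
      \<otimes>\<^bsub>matrix_ring n A\<^esub> M) l \<one>\<^bsub>matrix_ring n A\<^esub> = ?P"
    using Cons by simp
  ultimately show ?case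
    by (simp only: foldr.simps o_apply)
qed

section \<open>Additive functionals applied to the standard polynomial\<close>

text \<open>Turns the signs, which act as integer multiples in the group, into factors in a
  commutative ring. Additivity is assumed on the carrier alone, which is where
  \<open>grassmann_top_add\<close> provides it.\<close>

lemma (in abelian_group) additive_int_combination:
  fixes h :: "'a \<Rightarrow> 'c::comm_ring_1" and z :: "'s \<Rightarrow> int"
  assumes add: "\<And>x y. x \<in> carrier G \<Longrightarrow> y \<in> carrier G \<Longrightarrow> h (x \<oplus> y) = h x + h y"
    and S: "finite S" and x: "\<And>s. s \<in> S \<Longrightarrow> x s \<in> carrier G"
  shows "h (\<Oplus>s\<in>S. [z s] \<cdot>\<^bsub>G\<^esub> x s) = (\<Sum>s\<in>S. of_int (z s) * h (x s))"
proof -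
  have h0: "h \<zero> = 0"
    using add[of \<zero> \<zero>] by simp
  have nat: "h ([k] \<cdot>\<^bsub>G\<^esub> a) = of_nat k * h a" if "a \<in> carrier G" for k :: nat and a
    using that by (induction k) (simp_all add: h0 add distrib_right add.commute)
  have neg: "h (\<ominus> a) = - h a" if "a \<in> carrier G" for a
    using add[of "\<ominus> a" a] that h0 by (simp add: l_neg eq_neg_iff_add_eq_0)
  have int: "h ([k] \<cdot>\<^bsub>G\<^esub> a) = of_int k * h a" if "a \<in> carrier G" for k :: int and a
    using that nat[OF that, of "nat k"] nat[OF that, of "nat (- k)"]
    by (cases "k \<ge> 0") (simp_all add: add_pow_int_ge add_pow_int_lt neg of_nat_nat)
  show ?thesis
    using S x
    by (induction S) (simp_all add: h0 add int Pi_def)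
qed

lemma standard_polynomial_additive:
  fixes h :: "'r \<Rightarrow> 'c::comm_ring_1"
  assumes "abelian_group A"
    and "\<And>y z. y \<in> carrier A \<Longrightarrow> z \<in> carrier A \<Longrightarrow> h (y \<oplus>\<^bsub>A\<^esub> z) = h y + h z"
    and "\<And>\<pi>. \<pi> permutes {1..k} \<Longrightarrow>
      foldr (\<lambda>i y. x (\<pi> i) \<otimes>\<^bsub>A\<^esub> y) [1..<Suc k] \<one>\<^bsub>A\<^esub> \<in> carrier A"
  shows "h (standard_polynomial A k x) = (\<Sum>\<pi> | \<pi> permutes {1..k}. of_int (sign \<pi>) *
      h (foldr (\<lambda>i y. x (\<pi> i) \<otimes>\<^bsub>A\<^esub> y) [1..<Suc k] \<one>\<^bsub>A\<^esub>))"
  unfolding standard_polynomial_def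
  by (intro abelian_group.additive_int_combination assms) (simp_all add: finite_permutations)

section \<open>The sum s_{N+1}(v_1, ..., v_N, 1) under the top form\<close>

text \<open>Letters outside \<open>{1..N}\<close>, in particular \<open>N + 1\<close>, stand for the unit.\<close>

definition unit_last :: "nat \<Rightarrow> nat \<Rightarrow> nat list" where
  "unit_last N i = (if i \<in> {1..N} then [i] else [])"

definition signed_top :: "nat \<Rightarrow> (nat \<Rightarrow> nat) \<Rightarrow> 'a::comm_ring_1" where
  "signed_top N \<pi> = of_int (sign \<pi>) *
     top_form N (Poly_Mapping.single (Word (concat (map (unit_last N \<circ> \<pi>) [1..<Suc (Suc N)]))) 1)"

text \<open>With the unit in the last place, \<open>\<pi>\<close> permutes 1..N and its word is
  \<open>perm_word N \<pi>\<close>. The sign occurs twice, in the term and in its top form, so each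
  of the N! terms is 1.\<close>

lemma sum_signed_top_unit_last:
  "(\<Sum>\<pi> | \<pi> permutes {1..Suc N} \<and> \<pi> (Suc N) = Suc N. signed_top N \<pi>) =
     (of_nat (fact N) :: 'a::comm_ring_1)"
proof -
  have eq: "{\<pi>. \<pi> permutes {1..Suc N} \<and> \<pi> (Suc N) = Suc N} = {\<pi>. \<pi> permutes {1..N}}"
  proof (intro Collect_cong iffI conjI)
    fix \<pi> assume \<pi>: "\<pi> permutes {1..Suc N} \<and> \<pi> (Suc N) = Suc N"
    show "\<pi> permutes {1..N}"
      by (rule permutes_superset[OF conjunct1[OF \<pi>]]) (use \<pi> in \<open>auto simp: le_Suc_eq\<close>)
  next
    fix \<pi> assume "\<pi> permutes {1..N}"
    then show "\<pi> permutes {1..Suc N}" "\<pi> (Suc N) = Suc N"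
      using permutes_subset[of \<pi> "{1..N}" "{1..Suc N}"] by (simp_all add: permutes_not_in)
  qed
  have "signed_top N \<pi> = (1::'a)" if "\<pi> permutes {1..N}" for \<pi>
  proof -
    have "map (unit_last N \<circ> \<pi>) [1..<Suc N] = map (\<lambda>i. [\<pi> i]) [1..<Suc N]"
    proof (rule map_cong[OF refl])
      fix i assume "i \<in> set [1..<Suc N]"
      then have "i \<in> {1..N}" by auto
      then have "\<pi> i \<in> {1..N}" by (simp only: permutes_in_image[OF that])
      then show "(unit_last N \<circ> \<pi>) i = [\<pi> i]" by (simp only: unit_last_def o_apply if_True)
    qed
    moreover have "unit_last N (\<pi> (Suc N)) = []"
      using that by (simp add: unit_last_def permutes_not_in)
    ultimately have "Word (concat (map (unit_last N \<circ> \<pi>) [1..<Suc (Suc N)])) = perm_word N \<pi>"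
      using upt_Suc_append[of 1 "Suc N"]
      by (simp only: perm_word_def map_append concat_append list.map concat.simps o_apply
          concat_map_singleton append_Nil2)
    then have "signed_top N \<pi> = (of_int (sign \<pi> * sign \<pi>) :: 'a)"
      using top_form_perm_word[OF that, where ?'a = 'a] by (simp only: signed_top_def of_int_mult)
    then show ?thesis by simp
  qed
  then have "(\<Sum>\<pi> | \<pi> permutes {1..N}. signed_top N \<pi>) = (\<Sum>\<pi> | \<pi> permutes {1..N}. (1::'a))"
    by (intro sum.cong) auto
  also have "\<dots> = of_nat (fact N)"
    by (simp add: card_permutations)
  finally show ?thesis unfolding eq .
qed

text \<open>Moving the unit by one place leaves the word unchanged but flips the sign of the permutation.\<close>

lemma sum_signed_top_shift:
  assumes "p \<in> {1..N}"
  shows "(\<Sum>\<pi> | \<pi> permutes {1..Suc N} \<and> \<pi> p = Suc N. signed_top N \<pi>) =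
     - (\<Sum>\<pi> | \<pi> permutes {1..Suc N} \<and> \<pi> (Suc p) = Suc N. (signed_top N \<pi> :: 'a::comm_ring_1))"
proof -
  define \<tau> where "\<tau> = transpose p (Suc p)"
  have \<tau>: "\<tau> permutes {1..Suc N}"
    unfolding \<tau>_def using assms by (intro permutes_swap_id) auto
  have \<tau>\<tau>: "\<pi> \<circ> \<tau> \<circ> \<tau> = \<pi>" for \<pi> :: "nat \<Rightarrow> nat"
    by (simp add: \<tau>_def comp_assoc)
  have \<tau>p: "\<tau> p = Suc p" "\<tau> (Suc p) = p" by (simp_all add: \<tau>_def)
  have top: "signed_top N (\<pi> \<circ> \<tau>) = - (signed_top N \<pi> :: 'a)"
    if "\<pi> permutes {1..Suc N}" "\<pi> p = Suc N" for \<pi>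
  proof -
    have split: "[1..<Suc (Suc N)] = [1..<p] @ p # Suc p # [Suc (Suc p)..<Suc (Suc N)]"
      using assms upt_add_eq_append[of 1 p "Suc (Suc N) - p"] by (simp add: upt_conv_Cons del: upt_Suc)
    have unchanged: "map (unit_last N \<circ> (\<pi> \<circ> \<tau>)) l = map (unit_last N \<circ> \<pi>) l"
      if "p \<notin> set l" "Suc p \<notin> set l" for l
      using that by (auto simp: \<tau>_def transpose_def)
    have "map (unit_last N \<circ> (\<pi> \<circ> \<tau>)) [1..<p] = map (unit_last N \<circ> \<pi>) [1..<p]"
      "map (unit_last N \<circ> (\<pi> \<circ> \<tau>)) [Suc (Suc p)..<Suc (Suc N)] =
        map (unit_last N \<circ> \<pi>) [Suc (Suc p)..<Suc (Suc N)]"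
      by (intro unchanged; simp del: upt_Suc)+
    moreover have "unit_last N (\<pi> p) = []" using that by (simp add: unit_last_def)
    ultimately have "concat (map (unit_last N \<circ> (\<pi> \<circ> \<tau>)) [1..<Suc (Suc N)]) =
        concat (map (unit_last N \<circ> \<pi>) [1..<Suc (Suc N)])"
      unfolding split by (simp only: map_append list.map concat_append concat.simps o_apply \<tau>p append_Nil)
    moreover have "sign (\<pi> \<circ> \<tau>) = - sign \<pi>"
      unfolding \<tau>_def by (rule sign_comp_transpose[OF that(1)]) simp
    ultimately show ?thesis by (simp add: signed_top_def del: upt_Suc)
  qed
  have "(\<Sum>\<pi> | \<pi> permutes {1..Suc N} \<and> \<pi> (Suc p) = Suc N. (signed_top N \<pi> :: 'a)) =
    (\<Sum>\<pi> | \<pi> permutes {1..Suc N} \<and> \<pi> p = Suc N. signed_top N (\<pi> \<circ> \<tau>))"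
    using \<tau>\<tau> \<tau>p permutes_compose[OF \<tau>]
    by (intro sum.reindex_bij_witness[where i = "\<lambda>\<pi>. \<pi> \<circ> \<tau>" and j = "\<lambda>\<pi>. \<pi> \<circ> \<tau>"]) auto
  also have "\<dots> = (\<Sum>\<pi> | \<pi> permutes {1..Suc N} \<and> \<pi> p = Suc N. - signed_top N \<pi>)"
    using top by (intro sum.cong) auto
  finally show ?thesis by (simp add: sum_negf)
qed

lemma sum_signed_top:
  assumes "even N"
  shows "(\<Sum>\<pi> | \<pi> permutes {1..Suc N}. signed_top N \<pi>) = (of_nat (fact N) :: 'a::comm_ring_1)"
proof -
  let ?S = "{\<pi>. \<pi> permutes {1..Suc N}}"
  define F where "F p = (\<Sum>\<pi> | \<pi> permutes {1..Suc N} \<and> \<pi> p = Suc N. (signed_top N \<pi> :: 'a))" for p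
  \<comment> \<open>\<open>j\<close> counts how far the unit has moved left from the last place;
    each move costs a sign.\<close>
  have F: "F (Suc N - j) = (-1) ^ j * of_nat (fact N)" if "j \<le> N" for j
    using that
  proof (induction j)
    case 0
    then show ?case using sum_signed_top_unit_last[of N, where ?'a = 'a] by (simp add: F_def)
  next
    case (Suc j)
    then have "F (Suc N - Suc j) = - F (Suc (Suc N - Suc j))"
      unfolding F_def by (intro sum_signed_top_shift) auto
    also have "Suc (Suc N - Suc j) = Suc N - j" using Suc by simp
    finally show ?case using Suc by simp
  qed
  \<comment> \<open>Terms are grouped by the position \<open>p\<close> of the unit, the preimage of
    \<open>Suc N\<close>.\<close>
  have "(\<Sum>\<pi>\<in>?S. signed_top N \<pi> :: 'a) =
      (\<Sum>p\<in>{1..Suc N}. \<Sum>\<pi> | \<pi> \<in> ?S \<and> inv_into UNIV \<pi> (Suc N) = p. signed_top N \<pi>)"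
    using permutes_in_image[OF permutes_inv[of _ "{1..Suc N}"]]
    by (intro sum.group[symmetric] finite_permutations) auto
  also have "\<dots> = (\<Sum>p\<in>{1..Suc N}. F p)"
    unfolding F_def by (intro sum.cong refl) (auto simp: permutes_inv_eq)
  also have "\<dots> = (\<Sum>j\<in>{..N}. F (Suc N - j))"
    by (intro sum.reindex_bij_witness[where i = "\<lambda>j. Suc N - j" and j = "\<lambda>p. Suc N - p"]) auto
  also have "\<dots> = (\<Sum>j\<in>{..N}. (-1) ^ j) * of_nat (fact N)"
    using F by (simp add: sum_distrib_right)
  also have "(\<Sum>j\<in>{..N}. (-1) ^ j) = (1::'a)"
  proof -
    have "(\<Sum>j\<le>2 * q. (-1) ^ j) = (1::'a)" for q by (induction q) simp_all
    then show ?thesis using assms by (auto elim: evenE)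
  qed
  finally show ?thesis by simp
qed

section \<open>Passage to the Grassmann algebra\<close>

definition grassmann_class :: "nat \<Rightarrow> (nc_word \<Rightarrow>\<^sub>0 'a::comm_ring_1) \<Rightarrow> (nc_word \<Rightarrow>\<^sub>0 'a) set" where
  "grassmann_class m f =
     genideal (free_algebra TYPE('a) m) (grassmann_relations m) +>\<^bsub>free_algebra TYPE('a) m\<^esub> f"

text \<open>Elements of the quotient are cosets; \<open>the_elem\<close> reads off the common value
  of the top form on a coset without choosing a representative.\<close>

definition grassmann_top :: "nat \<Rightarrow> (nc_word \<Rightarrow>\<^sub>0 'a::comm_ring_1) set \<Rightarrow> 'a" where
  "grassmann_top N C = the_elem (top_form N ` C)"

lemma ideal_grassmann:
  "ideal (genideal (free_algebra TYPE('a::comm_ring_1) m) (grassmann_relations m)) (free_algebra TYPE('a) m)"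
  by (intro ring.genideal_ideal ring_free_algebra grassmann_relations_subset)

lemma grassmann_class_hom:
  "grassmann_class m \<in> Ring.ring_hom (free_algebra TYPE('a::comm_ring_1) m) (grassmann_algebra TYPE('a) m)"
  using ideal.rcos_ring_hom[OF ideal_grassmann]
  by (simp add: grassmann_class_def[abs_def] grassmann_algebra_def)

lemma grassmann_class_surj:
  "carrier (grassmann_algebra TYPE('a::comm_ring_1) m) =
     grassmann_class m ` carrier (free_algebra TYPE('a) m)"
  by (auto simp: grassmann_algebra_def FactRing_def A_RCOSETS_def' grassmann_class_def)

text \<open>The coset is the ideal translated by \<open>f\<close>, and the top form kills the ideal.
  Membership of 0 ensures that the value at \<open>f\<close> is attained.\<close>

lemma grassmann_top_class:
  "grassmann_top N (grassmann_class m f) = top_form N (f :: nc_word \<Rightarrow>\<^sub>0 'a::comm_ring_1)"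
proof -
  let ?F = "free_algebra TYPE('a) m"
  let ?I = "genideal ?F (grassmann_relations m)"
  have "0 \<in> ?I"
    using additive_subgroup.zero_closed[OF ideal.axioms(1)[OF ideal_grassmann]]
    by (simp add: free_algebra_def)
  moreover have "grassmann_class m f = (\<lambda>a. a + f) ` ?I"
    by (auto simp: grassmann_class_def a_r_coset_def' free_algebra_def)
  ultimately have "top_form N ` grassmann_class m f = {top_form N f}"
    by (auto simp: image_image top_form_add top_form_genideal intro!: rev_image_eqI[of 0])
  then show ?thesis by (simp add: grassmann_top_def)
qed

lemma grassmann_top_add:
  assumes "x \<in> carrier (grassmann_algebra TYPE('a::comm_ring_1) m)"
    and "y \<in> carrier (grassmann_algebra TYPE('a) m)"
  shows "grassmann_top N (x \<oplus>\<^bsub>grassmann_algebra TYPE('a) m\<^esub> y) = grassmann_top N x + grassmann_top N y"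
proof -
  obtain f g where fg: "f \<in> carrier (free_algebra TYPE('a) m)" "g \<in> carrier (free_algebra TYPE('a) m)"
    "x = grassmann_class m f" "y = grassmann_class m g"
    using assms by (auto simp: grassmann_class_surj)
  then have "x \<oplus>\<^bsub>grassmann_algebra TYPE('a) m\<^esub> y = grassmann_class m (f + g)"
    using Ring.ring_hom_add[OF grassmann_class_hom fg(1,2)] by (simp add: free_algebra_def)
  then show ?thesis by (simp add: fg grassmann_top_class top_form_add)
qed

lemma grassmann_zero:
  "\<zero>\<^bsub>grassmann_algebra TYPE('a::comm_ring_1) m\<^esub> = grassmann_class m 0"
  using Ring.ring_hom_zero[OF grassmann_class_hom[of m, where ?'a = 'a] ring_free_algebra ring_grassmann_algebra]
  by (simp add: free_algebra_def)

definition word_class :: "nat \<Rightarrow> nat list \<Rightarrow> (nc_word \<Rightarrow>\<^sub>0 'a::comm_ring_1) set" where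
  "word_class m w = grassmann_class m (Poly_Mapping.single (Word w) 1)"

lemma word_class_closed:
  assumes "set w \<subseteq> {1..m}"
  shows "word_class m w \<in> carrier (grassmann_algebra TYPE('a::comm_ring_1) m)"
  using assms unfolding word_class_def grassmann_class_surj
  by (intro imageI) (simp add: free_algebra_def)

text \<open>The quotient map is multiplicative on polynomials in the letters 1..m, so products of
  word classes reduce to concatenation.\<close>

lemma foldr_word_class:
  assumes "\<And>i. i \<in> set l \<Longrightarrow> set (u i) \<subseteq> {1..m}"
  shows "foldr (\<lambda>i y. word_class m (u i) \<otimes>\<^bsub>grassmann_algebra TYPE('a) m\<^esub> y) l
      \<one>\<^bsub>grassmann_algebra TYPE('a::comm_ring_1) m\<^esub> = word_class m (concat (map u l))"
  using assms
proof (induction l)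
  case Nil
  show ?case
    using Ring.ring_hom_one[OF grassmann_class_hom[of m, where ?'a = 'a]]
    by (simp add: word_class_def free_algebra_def flip: zero_nc_word_def)
next
  case (Cons i l)
  have "Poly_Mapping.single (Word (u i)) (1::'a) \<in> carrier (free_algebra TYPE('a) m)"
    "Poly_Mapping.single (Word (concat (map u l))) (1::'a) \<in> carrier (free_algebra TYPE('a) m)"
    using Cons.prems by (auto simp: free_algebra_def)
  from Ring.ring_hom_mult[OF grassmann_class_hom this] show ?case
    using Cons by (simp add: word_class_def free_algebra_def mult_single plus_nc_word_def)
qed

section \<open>The substitution and its corner entry\<close>

theorem proposition9:
  fixes m n :: nat
  assumes "n \<ge> 1"
    and "CHAR('a::field) = 0 \<or> prime CHAR('a) \<and> CHAR('a) > 2 * (m div 2)"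
  shows "\<not> standard_identity (matrix_ring n (grassmann_algebra TYPE('a) m))
            (2 * (n + m div 2) - 1)"
proof
  let ?A = "grassmann_algebra TYPE('a) m"
  \<comment> \<open>The largest even number of available letters; \<open>sum_signed_top\<close> asks
    for evenness.\<close>
  define N where "N = 2 * (m div 2)"
  \<comment> \<open>Counts the \<open>n - 1\<close> steps and \<open>n - 1\<close> loops that follow
    the initial loop at the first vertex.\<close>
  define t where "t = 2 * (n - 1)"
  define k where "k = Suc N + t"
  \<comment> \<open>The offset \<open>Suc N\<close> makes the first \<open>N + 1\<close> edges loops
    at vertex 0: \<open>N\<close> for the letters and one for the plain matrix unit.\<close>
  define src where "src = stair_src (Suc N)"
  define tgt where "tgt = stair_tgt (Suc N)"
  define g where "g i = (word_class m (unit_last N i) :: (nc_word \<Rightarrow>\<^sub>0 'a) set)" for i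
  define x where "x i = mat n n (\<lambda>(r, c). if r = src i \<and> c = tgt i then g i else \<zero>\<^bsub>?A\<^esub>)" for i
  \<comment> \<open>Indices start at 0, so this reads the upper right corner, where the full
    staircase ends.\<close>
  define h where "h M = grassmann_top N (M $$ (0, n - 1))" for M :: "(nc_word \<Rightarrow>\<^sub>0 'a) set mat"
  assume "standard_identity (matrix_ring n ?A) (2 * (n + m div 2) - 1)"
  moreover have "2 * (n + m div 2) - 1 = k"
    using assms(1) by (simp add: k_def N_def t_def)
  moreover have unit_last: "set (unit_last N i) \<subseteq> {1..m}" for i
    by (auto simp: unit_last_def N_def)
  then have g: "g i \<in> carrier ?A" for i
    unfolding g_def by (rule word_class_closed)
  have zero: "\<zero>\<^bsub>?A\<^esub> \<in> carrier ?A"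
    using ring.ring_simprules(2)[OF ring_grassmann_algebra] .
  have "x i \<in> carrier (matrix_ring n ?A)" for i
    using g zero by (simp add: x_def mat_in_matrix_ring)
  ultimately have "standard_polynomial (matrix_ring n ?A) k x = \<zero>\<^bsub>matrix_ring n ?A\<^esub>"
    by (simp add: standard_identity_def)
  then have h_zero: "h (standard_polynomial (matrix_ring n ?A) k x) = 0"
    using assms(1) by (simp add: h_def matrix_ring_ops grassmann_zero grassmann_top_class)
  have prod: "foldr (\<lambda>i M. x (\<pi> i) \<otimes>\<^bsub>matrix_ring n ?A\<^esub> M) [1..<Suc k] \<one>\<^bsub>matrix_ring n ?A\<^esub> =
      mat n n (\<lambda>(r, c). if is_path src tgt r (map \<pi> [1..<Suc k]) c
        then word_class m (concat (map (unit_last N \<circ> \<pi>) [1..<Suc k])) else \<zero>\<^bsub>?A\<^esub>)"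
    if \<pi>: "\<pi> permutes {1..k}" for \<pi>
  proof -
    have "tgt (\<pi> i) < n" if "i \<in> {1..k}" for i
    proof -
      \<comment> \<open>Even the last edge \<open>k\<close> ends at \<open>n - 1\<close>, so every
        edge stays inside the matrix.\<close>
      have "\<pi> i - Suc N \<le> t" using permutes_in_image[OF \<pi>, of i] that by (auto simp: k_def)
      then show ?thesis using assms(1) by (simp add: tgt_def stair_tgt_def t_def)
    qed
    then have "foldr (\<lambda>i M. x i \<otimes>\<^bsub>matrix_ring n ?A\<^esub> M) (map \<pi> [1..<Suc k]) \<one>\<^bsub>matrix_ring n ?A\<^esub> =
      mat n n (\<lambda>(r, c). if is_path src tgt r (map \<pi> [1..<Suc k]) c
        then foldr (\<lambda>i y. g i \<otimes>\<^bsub>?A\<^esub> y) (map \<pi> [1..<Suc k]) \<one>\<^bsub>?A\<^esub> else \<zero>\<^bsub>?A\<^esub>)"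
      unfolding x_def using g
      by (intro matrix_ring_foldr_monomial ring_grassmann_algebra) (auto simp del: upt_Suc)
    also have "foldr (\<lambda>i y. g i \<otimes>\<^bsub>?A\<^esub> y) (map \<pi> [1..<Suc k]) \<one>\<^bsub>?A\<^esub> =
        word_class m (concat (map (unit_last N) (map \<pi> [1..<Suc k])))"
      unfolding g_def by (intro foldr_word_class unit_last)
    finally show ?thesis by (simp only: foldr_map map_map comp_def)
  qed
  have "h (standard_polynomial (matrix_ring n ?A) k x) =
    (\<Sum>\<pi> | \<pi> permutes {1..k}. of_int (sign \<pi>) *
      h (foldr (\<lambda>i M. x (\<pi> i) \<otimes>\<^bsub>matrix_ring n ?A\<^esub> M) [1..<Suc k] \<one>\<^bsub>matrix_ring n ?A\<^esub>))"
  proof (rule standard_polynomial_additive)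
    show "abelian_group (matrix_ring n ?A)"
      by (intro abelian_group_matrix_ring ring_grassmann_algebra)
    show "h (y \<oplus>\<^bsub>matrix_ring n ?A\<^esub> z) = h y + h z"
      if "y \<in> carrier (matrix_ring n ?A)" "z \<in> carrier (matrix_ring n ?A)" for y z
      using that assms(1) by (simp add: h_def matrix_ring_ops matrix_ring_carrier_iff grassmann_top_add)
    show "foldr (\<lambda>i M. x (\<pi> i) \<otimes>\<^bsub>matrix_ring n ?A\<^esub> M) [1..<Suc k] \<one>\<^bsub>matrix_ring n ?A\<^esub>
        \<in> carrier (matrix_ring n ?A)" if "\<pi> permutes {1..k}" for \<pi>
    proof -
      have "set (concat (map (unit_last N \<circ> \<pi>) [1..<Suc k])) \<subseteq> {1..m}"
        using unit_last by fastforce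
      from word_class_closed[OF this] show ?thesis
        unfolding prod[OF that] mat_in_matrix_ring using zero by auto
    qed
  qed
  also have "\<dots> = (\<Sum>\<pi> | \<pi> permutes {1..k}. if \<pi> permutes {1..Suc N} then signed_top N \<pi> else 0)"
  proof (intro sum.cong refl)
    fix \<pi> assume "\<pi> \<in> {\<pi>. \<pi> permutes {1..k}}"
    then have \<pi>: "\<pi> permutes {1..k}" by simp
    have path: "is_path src tgt 0 (map \<pi> [1..<Suc k]) (n - 1) \<longleftrightarrow> \<pi> permutes {1..Suc N}"
      using stair_path_iff[of \<pi> "Suc N" t] \<pi> by (simp add: src_def tgt_def k_def t_def del: upt_Suc)
    \<comment> \<open>The edges after \<open>Suc N\<close> stay in place and carry the empty word,
      so they drop out of the product.\<close>
    have "concat (map (unit_last N \<circ> \<pi>) [1..<Suc k]) =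
        concat (map (unit_last N \<circ> \<pi>) [1..<Suc (Suc N)])" if "\<pi> permutes {1..Suc N}"
    proof -
      have "[1..<Suc k] = [1..<Suc (Suc N)] @ [Suc (Suc N)..<Suc k]"
        using upt_add_eq_append[of 1 "Suc (Suc N)" t] by (simp add: k_def)
      moreover have "concat (map (unit_last N \<circ> \<pi>) [Suc (Suc N)..<Suc k]) = []"
        using that by (auto simp: permutes_not_in unit_last_def)
      ultimately show ?thesis by (simp del: upt_Suc)
    qed
    then show "of_int (sign \<pi>) *
        h (foldr (\<lambda>i M. x (\<pi> i) \<otimes>\<^bsub>matrix_ring n ?A\<^esub> M) [1..<Suc k] \<one>\<^bsub>matrix_ring n ?A\<^esub>) =
      (if \<pi> permutes {1..Suc N} then signed_top N \<pi> else 0)"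
      using assms(1) path unfolding prod[OF \<pi>] h_def
      by (simp add: signed_top_def word_class_def grassmann_zero grassmann_top_class del: upt_Suc)
  qed
  also have "\<dots> = (\<Sum>\<pi> | \<pi> permutes {1..Suc N}. signed_top N \<pi>)"
    using permutes_subset[of _ "{1..Suc N}" "{1..k}"]
    by (intro sum.mono_neutral_cong_right) (auto simp: finite_permutations k_def)
  also have "\<dots> = of_nat (fact N)"
    by (rule sum_signed_top) (simp add: N_def)
  finally have "h (standard_polynomial (matrix_ring n ?A) k x) = of_nat (fact N)" .
  \<comment> \<open>A prime above N does not divide N!; in characteristic 0 the claim is just that
    N! is not 0.\<close>
  moreover have "of_nat (fact N) \<noteq> (0::'a)"
    using assms(2) by (auto simp: of_nat_eq_0_iff_char_dvd prime_dvd_fact_iff N_def)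
  ultimately show False using h_zero by simp
qed

end
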